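(* Let $\Gamma$ be a free group on countably infinitely many free generators, let $A$ be the symmetric generating set consisting of these free generators and their inverses, and let $o$ be the identity. For a natural number $r$ let $A^{r}$ be the set of elements of $\Gamma$ of positive length at most $r$, and let $X$ be the Cayley graph of $\Gamma$ with respect to $A^{r}$ (vertices $\Gamma$, $x\sim y$ iff $x^{-1}y\in A^{r}$). Let $\mu$ be a probability measure on $A^{r}$ whose support generates $\Gamma$, and let $(Z_n)_{n\in\mathbb N}$ be the random walk $Z_0=o$, $Z_{n}=Z_{n-1}Y_n$ with $(Y_n)$ i.i.d. of law $\mu$. Then almost surely $(Z_n)$ converges, in the proper metric end topology $\tau_{\mathrm{P}}X$, to some proper metric end of $X$.
   Context: Length of $x\in\Gamma$: length of the shortest word in $A$ representing $x$ (length of $o$ is $0$). In the graph $X$ with metric $\mathrm{d}_X$: for $e\subseteq VX$, $e^{*}=VX\setminus e$ and $\theta e$ is the set of vertices of $e^{*}$ adjacent to a vertex of $e$. A ray is a sequence of pairwise distinct vertices with consecutive ones adjacent; it lies in $e$ if all but finitely many of its vertices are in $e$; $e$ separates two rays if one lies in $e$, the other in $e^{*}$. A metric cut is a set $e$ with $\operatorname{diam}\theta e<\infty$; a metric ray is a ray all of whose infinite subsequences have infinite diameter; two metric rays are metrically equivalent if no metric cut separates them; classes are proper metric ends; such an end lies in $e$ if all its rays lie in $e$; $\Omega_{\mathrm{P}}e$ is the set of them, $\Omega_{\mathrm{P}}X=\Omega_{\mathrm{P}}VX$. $\tau_{\mathrm{P}}X$ is the topology on $VX\cup\Omega_{\mathrm{P}}X$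 generated by $\{e\cup\Omega_{\mathrm{P}}e\mid e\subseteq VX,\ \operatorname{diam}\theta e<\infty\}$. *)

theory Defs
  imports "HOL-Probability.Probability" "HOL-Algebra.Generated_Groups"
begin

section \<open>Graphs and proper metric ends\<close>

record 'v graph =
  verts :: "'v set"
  adj :: "'v \<Rightarrow> 'v \<Rightarrow> bool"

definition walk_between :: "'v graph \<Rightarrow> nat \<Rightarrow> 'v \<Rightarrow> 'v \<Rightarrow> bool" where
  "walk_between X n x y \<longleftrightarrow>
     (\<exists>p :: nat \<Rightarrow> 'v. p 0 = x \<and> p n = y \<and> (\<forall>i\<le>n. p i \<in> verts X) \<and>
        (\<forall>i<n. adj X (p i) (p (Suc i))))"

text \<open>Vertices in different components have distance \<open>\<infinity>\<close>.\<close>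

definition gdist :: "'v graph \<Rightarrow> 'v \<Rightarrow> 'v \<Rightarrow> enat" where
  "gdist X x y = Inf {enat n | n. walk_between X n x y}"

definition gdiam :: "'v graph \<Rightarrow> 'v set \<Rightarrow> enat" where
  "gdiam X S = (SUP x\<in>S. SUP y\<in>S. gdist X x y)"

definition vboundary :: "'v graph \<Rightarrow> 'v set \<Rightarrow> 'v set" where
  "vboundary X e = {y \<in> verts X - e. \<exists>x\<in>e. adj X x y}"

definition is_ray :: "'v graph \<Rightarrow> (nat \<Rightarrow> 'v) \<Rightarrow> bool" where
  "is_ray X R \<longleftrightarrow> range R \<subseteq> verts X \<and> inj R \<and> (\<forall>n. adj X (R n) (R (Suc n)))"

definition ray_in :: "(nat \<Rightarrow> 'v) \<Rightarrow> 'v set \<Rightarrow> bool" where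
  "ray_in R e \<longleftrightarrow> finite (range R - e)"

definition separates :: "'v graph \<Rightarrow> 'v set \<Rightarrow> (nat \<Rightarrow> 'v) \<Rightarrow> (nat \<Rightarrow> 'v) \<Rightarrow> bool" where
  "separates X e R R' \<longleftrightarrow>
     (ray_in R e \<and> ray_in R' (verts X - e)) \<or> (ray_in R' e \<and> ray_in R (verts X - e))"

definition metric_cut :: "'v graph \<Rightarrow> 'v set \<Rightarrow> bool" where
  "metric_cut X e \<longleftrightarrow> e \<subseteq> verts X \<and> gdiam X (vboundary X e) < \<infinity>"

definition metric_ray :: "'v graph \<Rightarrow> (nat \<Rightarrow> 'v) \<Rightarrow> bool" where
  "metric_ray X R \<longleftrightarrow> is_ray X R \<and>
     (\<forall>s :: nat \<Rightarrow> nat. strict_mono s \<longrightarrow> gdiam X (range (R \<circ> s)) = \<infinity>)"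

definition metric_equiv :: "'v graph \<Rightarrow> ((nat \<Rightarrow> 'v) \<times> (nat \<Rightarrow> 'v)) set" where
  "metric_equiv X = {(R, R'). metric_ray X R \<and> metric_ray X R' \<and>
     (\<nexists>e. metric_cut X e \<and> separates X e R R')}"

definition proper_metric_ends :: "'v graph \<Rightarrow> (nat \<Rightarrow> 'v) set set" where
  "proper_metric_ends X = {R. metric_ray X R} // metric_equiv X"

definition ends_in :: "'v graph \<Rightarrow> 'v set \<Rightarrow> (nat \<Rightarrow> 'v) set set" where
  "ends_in X e = {\<xi> \<in> proper_metric_ends X. \<forall>R\<in>\<xi>. ray_in R e}"

text \<open>The points of the space are the vertices, tagged \<open>Inl\<close>, and the ends, tagged \<open>Inr\<close>.\<close>

definition proper_metric_end_topology :: "'v graph \<Rightarrow> ('v + (nat \<Rightarrow> 'v) set) topology" where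
  "proper_metric_end_topology X =
     topology_generated_by {Inl ` e \<union> Inr ` ends_in X e | e. metric_cut X e}"

section \<open>Free groups, word length and Cayley graphs\<close>

text \<open>The pair \<open>(s, True)\<close> stands for the letter \<open>s\<close>, and \<open>(s, False)\<close> for its inverse.\<close>

definition letter :: "('a, 'b) monoid_scheme \<Rightarrow> 'a \<times> bool \<Rightarrow> 'a" where
  "letter G l = (if snd l then fst l else inv\<^bsub>G\<^esub> (fst l))"

definition word_prod :: "('a, 'b) monoid_scheme \<Rightarrow> 'a list \<Rightarrow> 'a" where
  "word_prod G w = foldr (\<otimes>\<^bsub>G\<^esub>) w \<one>\<^bsub>G\<^esub>"

definition reduced_word :: "('a \<times> bool) list \<Rightarrow> bool" where
  "reduced_word w \<longleftrightarrow> successively (\<lambda>l m. \<not> (fst l = fst m \<and> snd l \<noteq> snd m)) w"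

definition free_group_on :: "('a, 'b) monoid_scheme \<Rightarrow> 'a set \<Rightarrow> bool" where
  "free_group_on G S \<longleftrightarrow> group G \<and> S \<subseteq> carrier G \<and> generate G S = carrier G \<and>
     (\<forall>w. set w \<subseteq> S \<times> UNIV \<and> reduced_word w \<and> w \<noteq> [] \<longrightarrow>
        word_prod G (map (letter G) w) \<noteq> \<one>\<^bsub>G\<^esub>)"

definition symm_gens :: "('a, 'b) monoid_scheme \<Rightarrow> 'a set \<Rightarrow> 'a set" where
  "symm_gens G S = S \<union> m_inv G ` S"

definition word_length :: "('a, 'b) monoid_scheme \<Rightarrow> 'a set \<Rightarrow> 'a \<Rightarrow> nat" where
  "word_length G A x = (LEAST n. \<exists>w. length w = n \<and> set w \<subseteq> A \<and> word_prod G w = x)"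

definition punctured_ball :: "('a, 'b) monoid_scheme \<Rightarrow> 'a set \<Rightarrow> nat \<Rightarrow> 'a set" where
  "punctured_ball G A r = {x \<in> carrier G. 0 < word_length G A x \<and> word_length G A x \<le> r}"

definition cayley_graph :: "('a, 'b) monoid_scheme \<Rightarrow> 'a set \<Rightarrow> 'a graph" where
  "cayley_graph G B = \<lparr>verts = carrier G,
     adj = (\<lambda>x y. x \<in> carrier G \<and> y \<in> carrier G \<and> inv\<^bsub>G\<^esub> x \<otimes>\<^bsub>G\<^esub> y \<in> B)\<rparr>"

text \<open>The increments are \<open>Y 1, Y 2, \<dots>\<close>; the value \<open>Y 0\<close> is not used.\<close>

primrec random_walk ::
    "('a, 'b) monoid_scheme \<Rightarrow> (nat \<Rightarrow> 'w \<Rightarrow> 'a) \<Rightarrow> nat \<Rightarrow> 'w \<Rightarrow> 'a" where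
  "random_walk G Y 0 \<omega> = \<one>\<^bsub>G\<^esub>"
| "random_walk G Y (Suc n) \<omega> = random_walk G Y n \<omega> \<otimes>\<^bsub>G\<^esub> Y (Suc n) \<omega>"

end

theory Submission
  imports Defs
begin

text \<open>
  A walk whose graph distance from every vertex tends to infinity crosses the bounded boundary of a
  metric cut only finitely often, so it converges to the end of its loop erasure. It remains to see
  that the word length of \<open>Z\<^sub>n\<close> tends to infinity almost surely.

  Let the free group act on \<open>\<nat>\<close> from the right: three of the free generators act by involutions \<open>s\<^sub>i\<close>
  exchanging the residue class \<open>i\<close> modulo 3 with its complement, all other generators act trivially.
  This action is paradoxical, hence \<open>\<Sum>\<^sub>i \<parallel>f - f \<circ> s\<^sub>i\<parallel>\<^sup>2 \<ge> \<parallel>f\<parallel>\<^sup>2 / 6\<close>, and since the support of \<open>\<mu>\<close> generates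
  the group, the Dirichlet form of the walk \<open>0 \<cdot> Z\<^sub>n\<close> dominates \<open>c \<parallel>f\<parallel>\<^sup>2\<close>. Applied to the truncated
  Green function \<open>g = \<Sum>\<^sub>k\<^sub><\<^sub>N P(0 \<cdot> Z\<^sub>k = \<cdot>)\<close>, this gives \<open>g \<le> 2 / c\<close> for all \<open>N\<close>, so by Borel-Cantelli every
  point of \<open>\<nat>\<close> is visited finitely often. As only three generators act nontrivially, a ball of the free
  group moves \<open>0\<close> to finitely many points, and each ball is therefore left for good.
\<close>

section \<open>Escaping walks converge to proper metric ends\<close>

lemma gdist_refl: "x \<in> verts X \<Longrightarrow> gdist X x x = 0"
proof -
  assume "x \<in> verts X"
  then have "walk_between X 0 x x"
    unfolding walk_between_def by (intro exI[of _ "\<lambda>_. x"]) auto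
  then have "gdist X x x \<le> enat 0"
    unfolding gdist_def by (intro Inf_lower) auto
  then show ?thesis by (simp add: zero_enat_def[symmetric])
qed

lemma gdist_le_gdiam: "x \<in> A \<Longrightarrow> y \<in> A \<Longrightarrow> gdist X x y \<le> gdiam X A"
  unfolding gdiam_def by (meson SUP_upper2 order_refl)

lemma gdist_le_imp_walk:
  assumes "gdist X x y \<le> enat N"
  obtains n where "n \<le> N" "walk_between X n x y"
proof -
  \<comment> \<open>An infimum is guaranteed to have a witness only below a strict bound, so
    \<open>N\<close> is first relaxed to \<open>Suc N\<close>.\<close>
  have "gdist X x y < enat (Suc N)"
    using assms by (meson enat_ord_simps(2) le_less_trans lessI)
  then obtain n where "walk_between X n x y" "enat n < enat (Suc N)"
    unfolding gdist_def Inf_less_iff by auto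
  then show ?thesis using that[of n] by simp
qed

text \<open>Loop erasure: from each vertex, jump to the step after its last visit.\<close>

lemma loop_erasure:
  fixes Z :: "nat \<Rightarrow> 'v"
  assumes verts: "\<And>n. Z n \<in> verts X" and adj: "\<And>n. adj X (Z n) (Z (Suc n))"
    and fin: "\<And>n. finite {m. Z m = Z n}"
  obtains t where "strict_mono t" "is_ray X (Z \<circ> t)"
proof -
  define last where "last n = Max {m. Z m = Z n}" for n
  have Z_last: "Z (last n) = Z n" for n
    using Max_in[OF fin[of n]] unfolding last_def by auto
  have last_ge: "m \<le> last n" if "Z m = Z n" for m n
    unfolding last_def using that fin by (intro Max_ge) auto
  define t where "t = rec_nat (last 0) (\<lambda>_ m. last (Suc m))"
  have t_Suc: "t (Suc k) = last (Suc (t k))" for k by (simp add: t_def)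
  have mono: "strict_mono t"
    unfolding strict_mono_Suc_iff t_Suc using last_ge by (simp add: Suc_le_lessD)
  \<comment> \<open>Every \<open>t k\<close> is a value of \<open>last\<close>, so it is the time of
    the final visit to its own vertex; any coincidence with a later \<open>t j\<close> would
    contradict this.\<close>
  have t_last: "last (t k) = t k" for k
  proof -
    obtain n where n: "t k = last n" by (cases k) (auto simp: t_def)
    then show ?thesis by (simp add: last_def Z_last[unfolded last_def])
  qed
  have neq: "Z (t i) \<noteq> Z (t j)" if "i < j" for i j
    using last_ge[of "t j" "t i"] t_last[of i] strict_monoD[OF mono that] by auto
  have "inj (Z \<circ> t)"
    by (intro linorder_injI) (use neq in auto)
  moreover have "adj X (Z (t k)) (Z (t (Suc k)))" for k
    by (simp add: t_Suc Z_last adj)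
  ultimately have "is_ray X (Z \<circ> t)"
    unfolding is_ray_def using verts by auto
  with mono show ?thesis using that by blast
qed

text \<open>A ray has infinitely many vertices, so it cannot lie both in a set and in its
  complement.\<close>

lemma metric_equiv_refl:
  assumes "metric_ray X R"
  shows "(R, R) \<in> metric_equiv X"
proof -
  have "infinite (range R)"
    using assms unfolding metric_ray_def is_ray_def by (auto dest: range_inj_infinite)
  moreover have "range R \<subseteq> (range R - e) \<union> (range R - (verts X - e))" for e by auto
  ultimately have "\<not> (ray_in R e \<and> ray_in R (verts X - e))" for e
    unfolding ray_in_def by (meson finite_Un finite_subset)
  then show ?thesis
    using assms unfolding metric_equiv_def separates_def by auto
qed

text \<open>By symmetry of adjacency, each passage of the walk between \<open>e\<close> and its
  complement, in either direction, has an endpoint in \<open>vboundary X e\<close>. A bounded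
  boundary is avoided from some time on, so the walk stays on one side; its loop erasure shows that
  this is the side containing the end.\<close>

lemma escaping_walk_converges:
  fixes Z :: "nat \<Rightarrow> 'v"
  assumes sym: "\<And>x y. adj X x y \<Longrightarrow> adj X y x"
    and verts: "\<And>n. Z n \<in> verts X" and adj: "\<And>n. adj X (Z n) (Z (Suc n))"
    and esc: "\<And>x N. x \<in> verts X \<Longrightarrow> eventually (\<lambda>n. enat N < gdist X x (Z n)) sequentially"
  shows "\<exists>\<xi> \<in> proper_metric_ends X.
           limitin (proper_metric_end_topology X) (\<lambda>n. Inl (Z n)) (Inr \<xi>) sequentially"
proof -
  \<comment> \<open>Case \<open>N = 0\<close> of the escape hypothesis: a positive distance from
    \<open>Z n\<close> rules out a return.\<close>
  have fin: "finite {m. Z m = Z n}" for n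
  proof -
    have "eventually (\<lambda>m. Z m \<noteq> Z n) sequentially"
      using esc[OF verts, of 0 n]
      by eventually_elim (auto simp: gdist_refl verts)
    then show ?thesis
      unfolding cofinite_eq_sequentially[symmetric] eventually_cofinite by simp
  qed
  obtain t where t: "strict_mono t" and ray: "is_ray X (Z \<circ> t)"
    using loop_erasure[of Z X] verts adj fin by metis
  define R where "R = Z \<circ> t"
  have "gdiam X (range (R \<circ> s)) = \<infinity>" if s: "strict_mono s" for s :: "nat \<Rightarrow> nat"
  proof (rule ccontr)
    assume "gdiam X (range (R \<circ> s)) \<noteq> \<infinity>"
    then obtain N where N: "gdiam X (range (R \<circ> s)) = enat N" by auto
    have "filterlim (t \<circ> s) sequentially sequentially"
      by (intro filterlim_subseq strict_mono_o t s)
    from eventually_compose_filterlim[OF esc[OF verts, of N "t (s 0)"] this]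
    obtain k where "enat N < gdist X (R (s 0)) (R (s k))"
      unfolding eventually_sequentially R_def by auto
    moreover have "gdist X (R (s 0)) (R (s k)) \<le> enat N"
      unfolding N[symmetric] by (intro gdist_le_gdiam) auto
    ultimately show False by simp
  qed
  with ray have mray: "metric_ray X R" unfolding metric_ray_def R_def by blast
  define \<xi> where "\<xi> = metric_equiv X `` {R}"
  have \<xi>: "\<xi> \<in> proper_metric_ends X"
    unfolding \<xi>_def proper_metric_ends_def using mray by (auto intro: quotientI)
  have R\<xi>: "R \<in> \<xi>" unfolding \<xi>_def using metric_equiv_refl[OF mray] by auto
  have stay: "eventually (\<lambda>n. Z n \<in> e) sequentially"
    if cut: "metric_cut X e" and end_in: "\<xi> \<in> ends_in X e" for e
  proof -
    have "eventually (\<lambda>n. Z n \<notin> vboundary X e) sequentially"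
    proof (cases "vboundary X e = {}")
      case False
      \<comment> \<open>With one boundary vertex \<open>y\<close> fixed, a vertex farther from
        \<open>y\<close> than the diameter cannot be in the boundary.\<close>
      then obtain y where y: "y \<in> vboundary X e" by blast
      obtain N where N: "gdiam X (vboundary X e) = enat N"
        using cut unfolding metric_cut_def by auto
      have "y \<in> verts X" using y unfolding vboundary_def by auto
      from esc[OF this, of N] show ?thesis
        by eventually_elim (use gdist_le_gdiam[OF y] N in \<open>metis leD\<close>)
    qed simp
    then obtain n0 where n0: "\<And>n. n \<ge> n0 \<Longrightarrow> Z n \<notin> vboundary X e"
      unfolding eventually_sequentially by auto
    have step: "Z n \<in> e \<longleftrightarrow> Z (Suc n) \<in> e" if "n \<ge> n0" for n
    proof -
      have "Z n \<notin> vboundary X e" "Z (Suc n) \<notin> vboundary X e" using n0 that by auto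
      then show ?thesis
        using verts[of n] verts[of "Suc n"] adj[of n] sym[OF adj[of n]]
        unfolding vboundary_def by blast
    qed
    have const: "Z n \<in> e \<longleftrightarrow> Z n0 \<in> e" if "n \<ge> n0" for n
      using that by (induction n rule: dec_induct) (simp_all add: step[symmetric])
    have "finite (range R - e)"
      using end_in R\<xi> unfolding ends_in_def ray_in_def by auto
    \<comment> \<open>The tail of \<open>R\<close> is infinite and only finitely many vertices of
      \<open>R\<close> miss \<open>e\<close>. Hence the walk is in \<open>e\<close> at some time
      \<open>t k\<close> after \<open>n0\<close>, which decides the side.\<close>
    moreover have "infinite (R ` {n0..})"
      using ray infinite_Ici[of n0] finite_imageD[of R "{n0..}"] inj_on_subset[of R UNIV "{n0..}"]
      unfolding is_ray_def R_def by auto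
    ultimately have "\<not> R ` {n0..} \<subseteq> range R - e"
      using finite_subset by blast
    then obtain k where k: "k \<ge> n0" "R k \<in> e" by auto
    moreover have "t k \<ge> n0" using k(1) seq_suble[OF t, of k] by simp
    ultimately have "Z n0 \<in> e" using const[of "t k"] unfolding R_def by simp
    then show ?thesis using const unfolding eventually_sequentially by blast
  qed
  let ?B = "{Inl ` e \<union> Inr ` ends_in X e | e. metric_cut X e}"
  have conv: "eventually (\<lambda>n. Inl (Z n) \<in> U) sequentially"
    if "generate_topology_on ?B U" "Inr \<xi> \<in> U" for U
    using that
  proof induction
    case (Int a b)
    then show ?case by (auto intro: eventually_conj)
  next
    case (UN K)
    then obtain k where "k \<in> K" "Inr \<xi> \<in> k" by auto
    then have "eventually (\<lambda>n. Inl (Z n) \<in> k) sequentially" using UN by auto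
    then show ?case by eventually_elim (use \<open>k \<in> K\<close> in auto)
  next
    case (Basis s)
    then obtain e where e: "s = Inl ` e \<union> Inr ` ends_in X e" "metric_cut X e" by auto
    with Basis.prems have "\<xi> \<in> ends_in X e" by auto
    from stay[OF e(2) this] show ?case by eventually_elim (auto simp: e(1))
  qed auto
  \<comment> \<open>The limit must be a point of the space. The whole vertex set serves as a cut
    containing the end: its boundary is empty and so has diameter 0.\<close>
  have "vboundary X (verts X) = {}" by (simp add: vboundary_def)
  then have "metric_cut X (verts X)"
    unfolding metric_cut_def gdiam_def by (simp add: bot_enat_def)
  moreover have "ray_in R' (verts X)" if "R' \<in> \<xi>" for R'
  proof -
    have "range R' \<subseteq> verts X"
      using that unfolding \<xi>_def metric_equiv_def metric_ray_def is_ray_def by auto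
    then show ?thesis unfolding ray_in_def by (metis Diff_eq_empty_iff finite.emptyI)
  qed
  then have "\<xi> \<in> ends_in X (verts X)" using \<xi> unfolding ends_in_def by blast
  ultimately have "Inr \<xi> \<in> topspace (proper_metric_end_topology X)"
    unfolding proper_metric_end_topology_def topology_generated_by_topspace by blast
  then have "limitin (proper_metric_end_topology X) (\<lambda>n. Inl (Z n)) (Inr \<xi>) sequentially"
    unfolding limitin_def using conv
    by (auto simp: proper_metric_end_topology_def openin_topology_generated_by_iff)
  with \<xi> show ?thesis by blast
qed

section \<open>Spectral gap and Green function\<close>

definition sqsum :: "('x \<Rightarrow> real) \<Rightarrow> real" where
  "sqsum f = (\<Sum>\<^sub>\<infinity>x. (f x)\<^sup>2)"

text \<open>All test functions below have finite support; this settles summability for their squares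
  and for any product with such a factor.\<close>

lemma finite_support_summable_on:
  fixes f g :: "'x \<Rightarrow> real"
  assumes "finite {x. f x \<noteq> 0}" and "\<And>x. f x = 0 \<Longrightarrow> g x = 0"
  shows "g summable_on A"
  by (rule finite_nonzero_values_imp_summable_on)
    (use assms in \<open>auto intro: finite_subset[OF _ assms(1)]\<close>)

lemma finite_support_comp_bij:
  assumes "finite {x. f x \<noteq> 0}" "bij \<sigma>"
  shows "finite {x. f (\<sigma> x) \<noteq> 0}"
  using finite_vimageI[OF assms(1), of \<sigma>] assms(2) by (auto simp: vimage_def bij_def)

lemma finite_support_diff:
  fixes f g :: "'x \<Rightarrow> real"
  assumes "finite {x. f x \<noteq> 0}" "finite {x. g x \<noteq> 0}"
  shows "finite {x. f x - g x \<noteq> 0}"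
  by (rule finite_subset[OF _ finite_UnI[OF assms]]) auto

lemma finite_support_sq_summable:
  fixes f :: "'x \<Rightarrow> real"
  shows "finite {x. f x \<noteq> 0} \<Longrightarrow> (\<lambda>x. (f x)\<^sup>2) summable_on A"
  by (erule finite_support_summable_on) simp

lemma sqsum_comp_bij: "bij \<sigma> \<Longrightarrow> sqsum (\<lambda>x. f (\<sigma> x)) = sqsum f"
  unfolding sqsum_def by (rule infsum_reindex_bij_betw[where f = "\<lambda>x. (f x)\<^sup>2"])

text \<open>Reindexing by \<open>\<sigma>\<close> turns one difference into the negative of the
  other, and the square removes the sign.\<close>

lemma sqsum_diff_inv:
  assumes "bij \<sigma>"
  shows "sqsum (\<lambda>x. f x - f (inv_into UNIV \<sigma> x)) = sqsum (\<lambda>x. f x - f (\<sigma> x))"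
  using sqsum_comp_bij[OF assms, of "\<lambda>x. f x - f (inv_into UNIV \<sigma> x)"] assms
  by (simp add: bij_is_inj inv_f_f sqsum_def power2_commute)

text \<open>Split the difference at \<open>f (\<sigma> x)\<close>, use
  \<open>(a + b)\<^sup>2 \<le> 2 * a\<^sup>2 + 2 * b\<^sup>2\<close>, and reindex the second part by
  \<open>\<sigma>\<close>. This carries displacement bounds from group elements to their
  products.\<close>

lemma sqsum_diff_comp:
  assumes f: "finite {x. f x \<noteq> 0}" and "bij \<sigma>" "bij \<tau>"
  shows "sqsum (\<lambda>x. f x - f (\<tau> (\<sigma> x)))
           \<le> 2 * sqsum (\<lambda>x. f x - f (\<sigma> x)) + 2 * sqsum (\<lambda>x. f x - f (\<tau> x))"
proof -
  note f\<sigma> = finite_support_comp_bij[OF f \<open>bij \<sigma>\<close>] and f\<tau> = finite_support_comp_bij[OF f \<open>bij \<tau>\<close>]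
  note f\<tau>\<sigma> = finite_support_comp_bij[OF f\<tau> \<open>bij \<sigma>\<close>]
  have fin: "finite {x. f x - f (\<sigma> x) \<noteq> 0}" "finite {x. f x - f (\<tau> x) \<noteq> 0}"
    "finite {x. f x - f (\<tau> (\<sigma> x)) \<noteq> 0}" "finite {x. f (\<sigma> x) - f (\<tau> (\<sigma> x)) \<noteq> 0}"
    by (intro finite_support_diff f f\<sigma> f\<tau> f\<tau>\<sigma>)+
  note summ = fin[THEN finite_support_sq_summable[where A = UNIV]]
  have "(f x - f (\<tau> (\<sigma> x)))\<^sup>2
      \<le> 2 * (f x - f (\<sigma> x))\<^sup>2 + 2 * (f (\<sigma> x) - f (\<tau> (\<sigma> x)))\<^sup>2" for x
    using zero_le_power2[of "(f x - f (\<sigma> x)) - (f (\<sigma> x) - f (\<tau> (\<sigma> x)))"]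
    by (simp add: power2_eq_square algebra_simps)
  then have "sqsum (\<lambda>x. f x - f (\<tau> (\<sigma> x)))
      \<le> (\<Sum>\<^sub>\<infinity>x. 2 * (f x - f (\<sigma> x))\<^sup>2 + 2 * (f (\<sigma> x) - f (\<tau> (\<sigma> x)))\<^sup>2)"
    unfolding sqsum_def by (intro infsum_mono summ summable_on_add summable_on_cmult_right)
  also have "\<dots> = 2 * sqsum (\<lambda>x. f x - f (\<sigma> x)) + 2 * sqsum (\<lambda>x. f (\<sigma> x) - f (\<tau> (\<sigma> x)))"
    unfolding sqsum_def
    by (subst infsum_add) (auto intro!: summ summable_on_cmult_right simp: infsum_cmult_right')
  also have "sqsum (\<lambda>x. f (\<sigma> x) - f (\<tau> (\<sigma> x))) = sqsum (\<lambda>x. f x - f (\<tau> x))"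
    by (rule sqsum_comp_bij[OF \<open>bij \<sigma>\<close>, of "\<lambda>x. f x - f (\<tau> x)"])
  finally show ?thesis .
qed

text \<open>If three disjoint sets are each equinumerous with their complement, their total mass under a
  nearly invariant \<open>f\<^sup>2\<close> would be about three halves of the whole.\<close>

lemma paradoxical_spectral_gap:
  fixes s :: "nat \<Rightarrow> 'x \<Rightarrow> 'x" and W :: "nat \<Rightarrow> 'x set"
  assumes f: "finite {x. f x \<noteq> 0}"
    and s: "\<And>i. i < 3 \<Longrightarrow> bij (s i)"
    and sW: "\<And>i. i < 3 \<Longrightarrow> bij_betw (s i) (W i) (- W i)"
    and disj: "disjoint_family_on W {..<3}"
  shows "sqsum f \<le> 6 * (\<Sum>i<3. sqsum (\<lambda>x. f x - f (s i x)))"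
proof -
  define m where "m A = (\<Sum>\<^sub>\<infinity>x\<in>A. (f x)\<^sup>2)" for A
  note f2 = finite_support_sq_summable[OF f]
  have m_split: "sqsum f = m A + m (- A)" for A
    using infsum_Un_disjoint[of "\<lambda>x. (f x)\<^sup>2" A "- A"] f2 by (simp add: m_def sqsum_def)
  have one: "sqsum f - 2 * m (W i) \<le> 3 * sqsum (\<lambda>x. f x - f (s i x)) + sqsum f / 6"
    if i: "i < 3" for i
  proof -
    have fs: "finite {x. f (s i x) \<noteq> 0}"
      by (rule finite_support_comp_bij[OF f s[OF i]])
    note fs2 = finite_support_sq_summable[OF fs]
    note d2 = finite_support_sq_summable[OF finite_support_diff[OF f fs]]
    have mc: "m (- W i) = (\<Sum>\<^sub>\<infinity>x\<in>W i. (f (s i x))\<^sup>2)"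
      unfolding m_def by (rule infsum_reindex_bij_betw[OF sW[OF i], symmetric])
    \<comment> \<open>Write the difference of squares as \<open>u * v\<close> with
      \<open>u = f (s i x) - f x\<close> and \<open>v = f (s i x) + f x\<close>. Young's inequality
      gives \<open>u * v \<le> 3 * u\<^sup>2 + v\<^sup>2 / 12\<close>, and \<open>v\<^sup>2\<close>
      is at most twice the sum of the two squares.\<close>
    have pw: "(f (s i x))\<^sup>2 \<le> (f x)\<^sup>2 + (3 * (f x - f (s i x))\<^sup>2 + ((f x)\<^sup>2 + (f (s i x))\<^sup>2) * (1/6))" for x
    proof -
      have "0 \<le> (6 * (f (s i x) - f x) - (f (s i x) + f x))\<^sup>2 + (f (s i x) - f x)\<^sup>2" by simp
      then have "12 * (f (s i x))\<^sup>2 \<le> 12 * (f x)\<^sup>2 + 36 * (f x - f (s i x))\<^sup>2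
          + 2 * ((f x)\<^sup>2 + (f (s i x))\<^sup>2)"
        by (simp add: power2_eq_square algebra_simps)
      then show ?thesis by linarith
    qed
    have "m (- W i) \<le> (\<Sum>\<^sub>\<infinity>x\<in>W i. (f x)\<^sup>2 + (3 * (f x - f (s i x))\<^sup>2 + ((f x)\<^sup>2 + (f (s i x))\<^sup>2) * (1/6)))"
      unfolding mc using pw
      by (intro infsum_mono f2 fs2 d2 summable_on_add summable_on_cmult_right summable_on_cmult_left)
    also have "\<dots> = m (W i) + (3 * (\<Sum>\<^sub>\<infinity>x\<in>W i. (f x - f (s i x))\<^sup>2) + (m (W i) + m (- W i)) * (1/6))"
      unfolding mc unfolding m_def
      by (simp only: infsum_add f2 fs2 d2 summable_on_add summable_on_cmult_right summable_on_cmult_left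
            infsum_cmult_right' infsum_cmult_left')
    also have "(\<Sum>\<^sub>\<infinity>x\<in>W i. (f x - f (s i x))\<^sup>2) \<le> sqsum (\<lambda>x. f x - f (s i x))"
      unfolding sqsum_def by (intro infsum_mono2 d2) auto
    finally show ?thesis using m_split[of "W i"] by (simp add: field_simps)
  qed
  have "(\<Sum>i<3. m (W i)) = m (\<Union>i<3. W i)"
    unfolding m_def using disj f2
    by (intro sum_infsum) (auto simp: disjoint_family_on_def)
  also have "\<dots> \<le> sqsum f"
    unfolding m_def sqsum_def by (intro infsum_mono2 f2) auto
  finally have "(\<Sum>i<3. m (W i)) \<le> sqsum f" .
  moreover have "(\<Sum>i<3. sqsum f - 2 * m (W i))
      \<le> (\<Sum>i<3. 3 * sqsum (\<lambda>x. f x - f (s i x)) + sqsum f / 6)"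
    by (intro sum_mono one) auto
  \<comment> \<open>With \<open>q = sqsum f\<close> and \<open>D\<close> the sum of the three
    displacements, the two facts give \<open>3 * q - 2 * q \<le> 3 * D + q / 2\<close>.\<close>
  ultimately show ?thesis
    by (simp add: sum_subtractf sum.distrib flip: sum_distrib_left)
qed

section \<open>Green function estimate from a spectral gap\<close>

lemma infsum_finite_sum:
  fixes f :: "'i \<Rightarrow> 'x \<Rightarrow> real"
  assumes "\<And>i. i \<in> I \<Longrightarrow> f i summable_on A"
  shows "(\<Sum>\<^sub>\<infinity>x\<in>A. \<Sum>i\<in>I. f i x) = (\<Sum>i\<in>I. \<Sum>\<^sub>\<infinity>x\<in>A. f i x)"
proof -
  have "((\<lambda>x. \<Sum>i\<in>I. f i x) has_sum (\<Sum>i\<in>I. \<Sum>\<^sub>\<infinity>x\<in>A. f i x)) A"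
    using assms by (induction I rule: infinite_finite_induct) (auto intro!: has_sum_add has_sum_infsum)
  then show ?thesis by (rule infsumI)
qed

text \<open>Let \<open>P\<close> be the averaging operator in \<open>qrec\<close> and
  \<open>g\<close> the sum of the first \<open>N\<close> functions \<open>q k\<close>. Then
  \<open>P g = g - q 0 + q N\<close>, so the Dirichlet form of \<open>g\<close> is twice the inner
  product of \<open>g\<close> with \<open>q 0 - q N\<close>, hence at most \<open>2 * g x0\<close>.
  The gap yields \<open>c * sqsum g \<le> 2 * g x0\<close>; since each \<open>(g x)\<^sup>2\<close>
  is at most \<open>sqsum g\<close>, this bounds first \<open>g x0\<close> and then every
  \<open>g x\<close>.\<close>

lemma green_function_bound:
  fixes F :: "('x \<Rightarrow> 'x) set" and w :: "('x \<Rightarrow> 'x) \<Rightarrow> real" and q :: "nat \<Rightarrow> 'x \<Rightarrow> real"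
  assumes F: "finite F" "\<And>\<sigma>. \<sigma> \<in> F \<Longrightarrow> bij \<sigma>"
    and w1: "sum w F = 1"
    and q0: "\<And>x. q 0 x = (if x = x0 then 1 else 0)"
    and qpos: "\<And>n x. 0 \<le> q n x"
    and qrec: "\<And>n x. q (Suc n) x = (\<Sum>\<sigma>\<in>F. w \<sigma> * q n (inv_into UNIV \<sigma> x))"
    and c: "c > 0"
    and gap: "\<And>f. finite {x. f x \<noteq> 0} \<Longrightarrow> c * sqsum f \<le> (\<Sum>\<sigma>\<in>F. w \<sigma> * sqsum (\<lambda>x. f x - f (\<sigma> x)))"
  shows "(\<Sum>k<N. q k x) \<le> 2 / c"
proof -
  have inv_bij: "bij (inv_into UNIV \<sigma>)" if "\<sigma> \<in> F" for \<sigma> using F that by (simp add: bij_imp_bij_inv)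
  have finq: "finite {x. q n x \<noteq> 0}" for n
  proof (induction n)
    case (Suc n)
    have "{x. q (Suc n) x \<noteq> 0} \<subseteq> (\<Union>\<sigma>\<in>F. {x. q n (inv_into UNIV \<sigma> x) \<noteq> 0})"
    proof
      fix x assume "x \<in> {x. q (Suc n) x \<noteq> 0}"
      then obtain \<sigma> where "\<sigma> \<in> F" "w \<sigma> * q n (inv_into UNIV \<sigma> x) \<noteq> 0"
        unfolding qrec mem_Collect_eq by (rule sum.not_neutral_contains_not_neutral)
      then show "x \<in> (\<Union>\<sigma>\<in>F. {x. q n (inv_into UNIV \<sigma> x) \<noteq> 0})" by auto
    qed
    then show ?case
      by (rule finite_subset) (use F(1) inv_bij Suc in \<open>blast intro: finite_support_comp_bij\<close>)
  qed (simp add: q0)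
  define g where "g x = (\<Sum>k<N. q k x)" for x
  have gpos: "0 \<le> g x" for x unfolding g_def by (intro sum_nonneg qpos)
  have "{x. g x \<noteq> 0} \<subseteq> (\<Union>k<N. {x. q k x \<noteq> 0})"
    unfolding g_def by (fastforce intro: sum.neutral)
  then have fing: "finite {x. g x \<noteq> 0}"
    by (rule finite_subset) (simp add: finq)
  note sg = finite_support_summable_on[OF fing, where A = UNIV]
  have Pg: "(\<Sum>\<sigma>\<in>F. w \<sigma> * g (inv_into UNIV \<sigma> x)) = g x - q 0 x + q N x" for x
  proof -
    have "(\<Sum>\<sigma>\<in>F. w \<sigma> * g (inv_into UNIV \<sigma> x)) = (\<Sum>k<N. q (Suc k) x)"
      unfolding g_def qrec sum_distrib_left by (rule sum.swap)
    also have "\<dots> = g x - q 0 x + q N x"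
      unfolding g_def using sum_lessThan_telescope[of "\<lambda>k. q k x" N]
      by (simp add: sum_subtractf)
    finally show ?thesis .
  qed
  \<comment> \<open>Expand the square: both quadratic terms have total \<open>sqsum g\<close>, and
    the mixed term is reindexed so that the inverse of \<open>\<sigma>\<close>, as in
    \<open>qrec\<close>, appears.\<close>
  have D: "sqsum (\<lambda>x. g x - g (\<sigma> x)) = 2 * sqsum g - 2 * (\<Sum>\<^sub>\<infinity>x. g x * g (inv_into UNIV \<sigma> x))"
    if \<sigma>: "\<sigma> \<in> F" for \<sigma>
  proof -
    note s2 = finite_support_sq_summable[OF fing] finite_support_sq_summable[OF finite_support_comp_bij[OF fing F(2)[OF \<sigma>]]]
    have sp: "(\<lambda>x. g x * g (\<sigma> x)) summable_on UNIV" by (rule sg) simp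
    have "sqsum (\<lambda>x. g x - g (\<sigma> x)) = (\<Sum>\<^sub>\<infinity>x. ((g x)\<^sup>2 + (g (\<sigma> x))\<^sup>2) + (-2) * (g x * g (\<sigma> x)))"
      unfolding sqsum_def by (intro infsum_cong) (simp add: power2_eq_square algebra_simps)
    also have "\<dots> = (sqsum g + sqsum (\<lambda>x. g (\<sigma> x))) + (-2) * (\<Sum>\<^sub>\<infinity>x. g x * g (\<sigma> x))"
      unfolding sqsum_def
      by (simp only: infsum_add s2 sp summable_on_add summable_on_cmult_right infsum_cmult_right')
    also have "(\<Sum>\<^sub>\<infinity>x. g x * g (\<sigma> x)) = (\<Sum>\<^sub>\<infinity>x. g x * g (inv_into UNIV \<sigma> x))"
      using infsum_reindex_bij_betw[OF F(2)[OF \<sigma>], of "\<lambda>x. g x * g (inv_into UNIV \<sigma> x)"] F(2)[OF \<sigma>]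
      by (simp add: bij_is_inj inv_f_f mult.commute)
    finally show ?thesis using sqsum_comp_bij[OF F(2)[OF \<sigma>], of g] by simp
  qed
  have gq: "(\<lambda>x. g x * q n x) summable_on UNIV" for n by (rule sg) simp
  have "c * sqsum g \<le> (\<Sum>\<sigma>\<in>F. w \<sigma> * sqsum (\<lambda>x. g x - g (\<sigma> x)))" by (rule gap[OF fing])
  also have "\<dots> = (\<Sum>\<sigma>\<in>F. 2 * sqsum g * w \<sigma> - 2 * (w \<sigma> * (\<Sum>\<^sub>\<infinity>x. g x * g (inv_into UNIV \<sigma> x))))"
    by (intro sum.cong) (auto simp: D algebra_simps)
  also have "\<dots> = 2 * sqsum g - 2 * (\<Sum>\<sigma>\<in>F. w \<sigma> * (\<Sum>\<^sub>\<infinity>x. g x * g (inv_into UNIV \<sigma> x)))"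
    by (simp add: sum_subtractf w1 flip: sum_distrib_left)
  also have "(\<Sum>\<sigma>\<in>F. w \<sigma> * (\<Sum>\<^sub>\<infinity>x. g x * g (inv_into UNIV \<sigma> x))) = (\<Sum>\<^sub>\<infinity>x. \<Sum>\<sigma>\<in>F. w \<sigma> * (g x * g (inv_into UNIV \<sigma> x)))"
    by (subst infsum_finite_sum, intro summable_on_cmult_right sg)
      (simp_all add: infsum_cmult_right')
  also have "\<dots> = (\<Sum>\<^sub>\<infinity>x. g x * (\<Sum>\<sigma>\<in>F. w \<sigma> * g (inv_into UNIV \<sigma> x)))"
    by (intro infsum_cong) (simp add: sum_distrib_left mult.left_commute)
  also have "\<dots> = (\<Sum>\<^sub>\<infinity>x. (g x)\<^sup>2 + (g x * q N x + (-1) * (g x * q 0 x)))"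
    unfolding Pg by (intro infsum_cong) (simp add: power2_eq_square algebra_simps)
  also have "\<dots> = sqsum g + ((\<Sum>\<^sub>\<infinity>x. g x * q N x) + (-1) * (\<Sum>\<^sub>\<infinity>x. g x * q 0 x))"
    unfolding sqsum_def
    by (simp only: infsum_add finite_support_sq_summable[OF fing] gq summable_on_add
          summable_on_cmult_right infsum_cmult_right')
  also have "(\<Sum>\<^sub>\<infinity>x. g x * q 0 x) = (\<Sum>\<^sub>\<infinity>x\<in>{x0}. g x)"
    by (intro infsum_cong_neutral) (auto simp: q0)
  also have "\<dots> = g x0" by simp
  finally have "c * sqsum g \<le> 2 * g x0 - 2 * (\<Sum>\<^sub>\<infinity>x. g x * q N x)" by simp
  moreover have "0 \<le> (\<Sum>\<^sub>\<infinity>x. g x * q N x)" by (intro infsum_nonneg mult_nonneg_nonneg gpos qpos)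
  ultimately have *: "c * sqsum g \<le> 2 * g x0" by simp
  have ptw: "(g x)\<^sup>2 \<le> sqsum g" for x
    using infsum_mono2[of "\<lambda>x. (g x)\<^sup>2" "{x}" UNIV] finite_support_sq_summable[OF fing]
    by (simp add: sqsum_def)
  have "g x0 * (c * g x0) \<le> g x0 * 2"
  proof -
    have "c * (g x0)\<^sup>2 \<le> c * sqsum g" using ptw c by (intro mult_left_mono) auto
    with * show ?thesis by (simp add: power2_eq_square mult_ac)
  qed
  then have "c * g x0 \<le> 2"
    using gpos[of x0] by (cases "g x0 = 0") (auto simp: mult_le_cancel_left)
  \<comment> \<open>Feeding \<open>c * g x0 \<le> 2\<close> back into the starred estimate bounds
    \<open>c\<^sup>2 * sqsum g\<close> by 4.\<close>
  moreover have "c * (c * sqsum g) \<le> c * (2 * g x0)" using * c by (intro mult_left_mono) auto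
  ultimately have "c\<^sup>2 * sqsum g \<le> 2\<^sup>2" by (simp add: power2_eq_square mult_ac)
  moreover have "(c * g x)\<^sup>2 \<le> c\<^sup>2 * sqsum g"
    unfolding power_mult_distrib using ptw by (intro mult_left_mono) auto
  ultimately have "(c * g x)\<^sup>2 \<le> 2\<^sup>2" by linarith
  then have "c * g x \<le> 2" by (rule power2_le_imp_le) simp
  then show ?thesis using c unfolding g_def by (simp add: field_simps)
qed

section \<open>Word length and actions of free groups\<close>

lemma word_prod_Nil [simp]: "word_prod G [] = \<one>\<^bsub>G\<^esub>"
  and word_prod_Cons [simp]: "word_prod G (x # w) = x \<otimes>\<^bsub>G\<^esub> word_prod G w"
  by (simp_all add: word_prod_def)

context group
begin

lemma word_prod_closed: "set w \<subseteq> carrier G \<Longrightarrow> word_prod G w \<in> carrier G"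
  by (induction w) auto

lemma word_prod_append:
  "set w \<subseteq> carrier G \<Longrightarrow> set v \<subseteq> carrier G \<Longrightarrow>
    word_prod G (w @ v) = word_prod G w \<otimes> word_prod G v"
  by (induction w) (auto simp: word_prod_closed m_assoc)

lemma word_prod_inv:
  "set w \<subseteq> carrier G \<Longrightarrow> word_prod G (rev (map (m_inv G) w)) = inv (word_prod G w)"
proof (induction w)
  case (Cons a w)
  then have "set (rev (map (m_inv G) w)) \<subseteq> carrier G" "set [inv a] \<subseteq> carrier G" by auto
  with Cons show ?case
    by (simp add: word_prod_append word_prod_closed inv_mult_group del: set_rev set_map)
qed simp

lemma generate_words:
  assumes "S \<subseteq> carrier G" "x \<in> generate G S"
  obtains w where "set w \<subseteq> symm_gens G S" "word_prod G w = x"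
proof -
  have sub: "symm_gens G S \<subseteq> carrier G" using assms(1) by (auto simp: symm_gens_def)
  have "\<exists>w. set w \<subseteq> symm_gens G S \<and> word_prod G w = x"
    using assms(2)
  proof induction
    case one
    show ?case by (intro exI[of _ "[]"]) simp
  next
    case (incl h)
    then show ?case using assms(1) by (intro exI[of _ "[h]"]) (auto simp: symm_gens_def)
  next
    case (inv h)
    then show ?case using assms(1) by (intro exI[of _ "[inv h]"]) (auto simp: symm_gens_def)
  next
    case (eng h1 h2)
    then obtain w1 w2 where "set w1 \<subseteq> symm_gens G S" "word_prod G w1 = h1"
      "set w2 \<subseteq> symm_gens G S" "word_prod G w2 = h2" by blast
    then show ?case using sub by (intro exI[of _ "w1 @ w2"]) (auto simp: word_prod_append)
  qed
  then show ?thesis using that by blast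
qed

end

section \<open>Word length and distance in the Cayley graph\<close>

locale symm_generated = group G for G (structure) +
  fixes A :: "'a set"
  assumes A_carrier: "A \<subseteq> carrier G"
    and A_inv: "m_inv G ` A \<subseteq> A"
    and A_words: "\<And>x. x \<in> carrier G \<Longrightarrow> \<exists>w. set w \<subseteq> A \<and> word_prod G w = x"
begin

lemma word_length_word:
  assumes "x \<in> carrier G"
  obtains w where "length w = word_length G A x" "set w \<subseteq> A" "word_prod G w = x"
proof -
  obtain v where "set v \<subseteq> A" "word_prod G v = x" using A_words[OF assms] by blast
  then have "\<exists>n w. length w = n \<and> set w \<subseteq> A \<and> word_prod G w = x" by blast
  from LeastI_ex[OF this] show ?thesis using that unfolding word_length_def by blast
qed

lemma word_length_le: "set w \<subseteq> A \<Longrightarrow> word_length G A (word_prod G w) \<le> length w"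
  unfolding word_length_def by (intro Least_le) blast

lemma word_length_one [simp]: "word_length G A \<one> = 0"
  using word_length_le[of "[]"] by simp

lemma word_length_mult:
  assumes "x \<in> carrier G" "y \<in> carrier G"
  shows "word_length G A (x \<otimes> y) \<le> word_length G A x + word_length G A y"
proof -
  obtain v where v: "length v = word_length G A x" "set v \<subseteq> A" "word_prod G v = x"
    using word_length_word[OF assms(1)] .
  obtain w where w: "length w = word_length G A y" "set w \<subseteq> A" "word_prod G w = y"
    using word_length_word[OF assms(2)] .
  have "word_prod G (v @ w) = x \<otimes> y"
    using v w A_carrier by (subst word_prod_append) auto
  then show ?thesis using word_length_le[of "v @ w"] v w by simp
qed

lemma word_length_inv:
  assumes "x \<in> carrier G"
  shows "word_length G A (inv x) = word_length G A x"
proof -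
  have le: "word_length G A (inv y) \<le> word_length G A y" if y: "y \<in> carrier G" for y
  proof -
    obtain w where w: "length w = word_length G A y" "set w \<subseteq> A" "word_prod G w = y"
      using word_length_word[OF y] .
    have "word_prod G (rev (map (m_inv G) w)) = inv y"
      using w A_carrier by (subst word_prod_inv) auto
    moreover have "set (rev (map (m_inv G) w)) \<subseteq> A" using w A_inv by auto
    ultimately show ?thesis using word_length_le[of "rev (map (m_inv G) w)"] w by simp
  qed
  show ?thesis using le[OF assms] le[of "inv x"] assms by simp
qed

lemma cayley_graph_adj_sym:
  assumes "adj (cayley_graph G (punctured_ball G A r)) x y"
  shows "adj (cayley_graph G (punctured_ball G A r)) y x"
proof -
  have "x \<in> carrier G" "y \<in> carrier G" using assms by (auto simp: cayley_graph_def)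
  then have "inv y \<otimes> x = inv (inv x \<otimes> y)" by (simp add: inv_mult_group)
  then show ?thesis using assms
    by (auto simp: cayley_graph_def punctured_ball_def word_length_inv)
qed

text \<open>Each edge multiplies on the right by an element of length at most \<open>r\<close>, and
  word length is subadditive.\<close>

lemma walk_between_word_length:
  assumes "walk_between (cayley_graph G (punctured_ball G A r)) n x y"
  shows "word_length G A (inv x \<otimes> y) \<le> n * r"
proof -
  let ?X = "cayley_graph G (punctured_ball G A r)"
  obtain p where p: "p 0 = x" "p n = y" "\<And>i. i \<le> n \<Longrightarrow> p i \<in> carrier G"
    "\<And>i. i < n \<Longrightarrow> adj ?X (p i) (p (Suc i))"
    using assms unfolding walk_between_def cayley_graph_def by auto
  have "word_length G A (inv x \<otimes> p i) \<le> i * r" if "i \<le> n" for i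
    using that
  proof (induction i)
    case 0
    then show ?case using p(3)[of 0] p(1) by simp
  next
    case (Suc i)
    have c: "x \<in> carrier G" "p i \<in> carrier G" "p (Suc i) \<in> carrier G"
      using p(3)[of 0] p(3)[of i] p(3)[of "Suc i"] p(1) Suc.prems by auto
    have eq: "inv x \<otimes> p (Suc i) = (inv x \<otimes> p i) \<otimes> (inv (p i) \<otimes> p (Suc i))"
      using c by (metis inv_closed inv_solve_left m_assoc m_closed)
    have "word_length G A (inv (p i) \<otimes> p (Suc i)) \<le> r"
      using p(4)[of i] Suc.prems by (auto simp: cayley_graph_def punctured_ball_def)
    then show ?case
      unfolding eq using word_length_mult[of "inv x \<otimes> p i" "inv (p i) \<otimes> p (Suc i)"] c Suc by simp
  qed
  then show ?thesis using p(2) by blast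
qed

text \<open>At most \<open>N\<close> edges lead from \<open>x\<close> only to elements of length at
  most \<open>word_length G A x + N * r\<close>, and the walk eventually exceeds this
  threshold.\<close>

lemma gdist_escape:
  assumes z: "\<And>n. z n \<in> carrier G" and x: "x \<in> carrier G"
    and lim: "\<And>K. eventually (\<lambda>n. K < word_length G A (z n)) sequentially"
  shows "eventually (\<lambda>n. enat N < gdist (cayley_graph G (punctured_ball G A r)) x (z n)) sequentially"
  using lim[of "word_length G A x + N * r"]
proof eventually_elim
  case (elim n)
  let ?X = "cayley_graph G (punctured_ball G A r)"
  show ?case
  proof (rule ccontr)
    assume "\<not> enat N < gdist ?X x (z n)"
    then obtain m where m: "m \<le> N" "walk_between ?X m x (z n)"
      using gdist_le_imp_walk[of ?X x "z n" N] by (auto simp: not_less)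
    have "word_length G A (inv x \<otimes> z n) \<le> N * r"
      using walk_between_word_length[OF m(2)] m(1) by (meson le_trans mult_le_mono1)
    moreover have "z n = x \<otimes> (inv x \<otimes> z n)" using x z by (simp flip: m_assoc)
    ultimately show False
      using elim word_length_mult[of x "inv x \<otimes> z n"] x z by simp
  qed
qed

end

section \<open>Actions of free groups by involutions\<close>

text \<open>By freeness a nonempty word representing the identity contains two adjacent mutually
  inverse letters. Both act by the same involution, so deleting them changes neither the product nor
  the action; induct on the length.\<close>

lemma (in group) free_group_word_collapse:
  assumes free: "free_group_on G S"
    and t: "\<And>a. a \<in> S \<Longrightarrow> t a \<circ> t a = id"
    and "set w \<subseteq> S \<times> UNIV" "word_prod G (map (letter G) w) = \<one>"
  shows "fold (\<lambda>l. t (fst l)) w = id"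
  using assms(3,4)
proof (induction "length w" arbitrary: w rule: less_induct)
  case less
  have S: "S \<subseteq> carrier G" using free by (simp add: free_group_on_def)
  have lett: "letter G l \<in> carrier G" if "l \<in> S \<times> UNIV" for l
    using that S by (auto simp: letter_def)
  show ?case
  proof (cases "w = []")
    case False
    then have "\<not> reduced_word w"
      using free less.prems unfolding free_group_on_def by blast
    then obtain i where i: "Suc i < length w" "fst (w ! i) = fst (w ! Suc i)"
      "snd (w ! i) \<noteq> snd (w ! Suc i)"
      unfolding reduced_word_def successively_conv_nth by auto
    define u where "u = take i w"
    define v where "v = drop (Suc (Suc i)) w"
    have w: "w = u @ w ! i # w ! Suc i # v"
      unfolding u_def v_def using i(1) by (metis Cons_nth_drop_Suc Suc_lessD append_take_drop_id)
    have in_S: "w ! i \<in> S \<times> UNIV" "w ! Suc i \<in> S \<times> UNIV" "set u \<subseteq> S \<times> UNIV" "set v \<subseteq> S \<times> UNIV"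
      using less.prems(1) i(1) unfolding u_def v_def
      by (auto dest: in_set_takeD in_set_dropD)
    define a where "a = fst (w ! i)"
    have a: "a \<in> S" using in_S(1) unfolding a_def by auto
    have cancel: "letter G (w ! i) \<otimes> letter G (w ! Suc i) = \<one>"
      using i(2,3) a S unfolding letter_def a_def by (auto simp: subset_iff)
    have clos: "set (map (letter G) u) \<subseteq> carrier G" "set (map (letter G) v) \<subseteq> carrier G"
      using in_S lett by auto
    have "word_prod G (map (letter G) w) = word_prod G (map (letter G) u) \<otimes>
        ((letter G (w ! i) \<otimes> letter G (w ! Suc i)) \<otimes> word_prod G (map (letter G) v))"
      using clos lett[OF in_S(1)] lett[OF in_S(2)]
      by (subst w) (simp add: word_prod_append word_prod_closed m_assoc)
    also have "\<dots> = word_prod G (map (letter G) (u @ v))"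
      using clos by (simp add: cancel word_prod_append word_prod_closed)
    finally have "word_prod G (map (letter G) (u @ v)) = \<one>" using less.prems(2) by simp
    moreover have "length (u @ v) < length w" by (simp add: u_def v_def) (use i(1) in linarith)
    ultimately have "fold (\<lambda>l. t (fst l)) (u @ v) = id"
      using in_S by (intro less.hyps) auto
    moreover have "fold (\<lambda>l. t (fst l)) w = fold (\<lambda>l. t (fst l)) v \<circ> (t a \<circ> t a) \<circ> fold (\<lambda>l. t (fst l)) u"
      by (subst w) (simp add: a_def i(2) comp_assoc)
    ultimately show ?thesis using t[OF a] by simp
  qed simp
qed

text \<open>The universal property of the free group for involutions. As \<open>fold\<close> applies
  the first letter first, this is a right action and \<open>\<rho>\<close> reverses products. The
  equal lengths in the first clause make images of balls finite once \<open>t\<close> takes finitely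
  many values on \<open>S\<close>.\<close>

lemma free_group_involution_action:
  fixes G (structure) and t :: "'a \<Rightarrow> 'x \<Rightarrow> 'x"
  assumes free: "free_group_on G S"
    and t: "\<And>a. a \<in> S \<Longrightarrow> t a \<circ> t a = id"
  obtains \<rho> where "\<And>w. set w \<subseteq> symm_gens G S \<Longrightarrow>
        \<exists>u. set u \<subseteq> t ` S \<and> length u = length w \<and> \<rho> (word_prod G w) = fold (\<lambda>\<sigma>. \<sigma>) u"
    "\<And>a. a \<in> S \<Longrightarrow> \<rho> a = t a"
    "\<And>x y. x \<in> carrier G \<Longrightarrow> y \<in> carrier G \<Longrightarrow> \<rho> (x \<otimes> y) = \<rho> y \<circ> \<rho> x"
    "\<rho> \<one> = id"
proof -
  interpret group G using free by (simp add: free_group_on_def)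
  have S: "S \<subseteq> carrier G" and gen: "generate G S = carrier G"
    using free by (simp_all add: free_group_on_def)
  define act where "act = fold (\<lambda>l :: 'a \<times> bool. t (fst l))"
  define repr where "repr w x \<longleftrightarrow> set w \<subseteq> S \<times> UNIV \<and> word_prod G (map (letter G) w) = x" for w x
  have lett: "set (map (letter G) w) \<subseteq> carrier G" if "set w \<subseteq> S \<times> UNIV" for w
    using that S by (auto simp: letter_def)
  have lift: "\<exists>v. length v = length w \<and> repr v (word_prod G w)" if "set w \<subseteq> symm_gens G S" for w
  proof -
    have "\<exists>l\<in>S \<times> UNIV. letter G l = x" if "x \<in> symm_gens G S" for x
    proof -
      from that obtain a where "a \<in> S" "x = a \<or> x = inv a" unfolding symm_gens_def by auto
      then have "letter G (a, True) = x \<or> letter G (a, False) = x" by (auto simp: letter_def)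
      with \<open>a \<in> S\<close> show ?thesis by blast
    qed
    then obtain h where h: "\<And>x. x \<in> symm_gens G S \<Longrightarrow> h x \<in> S \<times> UNIV \<and> letter G (h x) = x"
      by metis
    have "map (letter G) (map h w) = w" using that h by (simp add: map_idI subset_iff)
    moreover have "set (map h w) \<subseteq> S \<times> UNIV" using that h unfolding set_map by blast
    ultimately show ?thesis unfolding repr_def
      by (intro exI[of _ "map h w"]) simp
  qed
  have ex: "\<exists>w. repr w x" if "x \<in> carrier G" for x
    using generate_words[OF S, of x] that gen lift by metis
  have unique: "act w = act v" if wv: "repr w x" "repr v x" for w v x
  proof -
    \<comment> \<open>\<open>v'\<close> spells the inverse of \<open>x\<close>. Both
      \<open>w @ v'\<close> and \<open>v' @ v\<close> represent the identity, so
      \<open>act w\<close> and \<open>act v\<close> are inverse to the same map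
      \<open>act v'\<close>.\<close>
    define v' where "v' = rev (map (\<lambda>l. (fst l, \<not> snd l)) v)"
    have v': "set v' \<subseteq> S \<times> UNIV" using wv(2) unfolding v'_def repr_def by auto
    have "map (letter G) v' = rev (map (m_inv G) (map (letter G) v))"
      using wv(2) S unfolding v'_def repr_def letter_def by (auto simp: rev_map subset_iff)
    then have "word_prod G (map (letter G) v') = inv x"
      using wv(2) lett[of v] unfolding repr_def by (simp only: word_prod_inv)
    moreover have x: "x \<in> carrier G" using wv(2) lett[of v] word_prod_closed unfolding repr_def by auto
    ultimately have "word_prod G (map (letter G) (w @ v')) = \<one>"
      "word_prod G (map (letter G) (v' @ v)) = \<one>"
      using wv lett[of w] lett[of v] lett[OF v'] unfolding repr_def
      by (simp_all add: word_prod_append del: set_map)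
    then have 1: "act (w @ v') = id" and 2: "act (v' @ v) = id"
      using free_group_word_collapse[where w = "w @ v'", OF free t]
        free_group_word_collapse[where w = "v' @ v", OF free t] wv v'
      unfolding act_def repr_def by (simp_all del: fold_append map_append)
    have "act v' \<circ> act w = id" "act v \<circ> act v' = id"
      using 1 2 by (simp_all add: act_def)
    then show ?thesis by (metis comp_assoc comp_id id_comp)
  qed
  define \<rho> where "\<rho> x = act (SOME w. repr w x)" for x
  have \<rho>: "\<rho> x = act w" if "repr w x" for w x
    unfolding \<rho>_def using unique[OF someI[of "\<lambda>w. repr w x", OF that] that] .
  show ?thesis
  proof
    fix w assume "set w \<subseteq> symm_gens G S"
    then obtain v where v: "length v = length w" "repr v (word_prod G w)" using lift by blast
    have "act v = fold (\<lambda>\<sigma>. \<sigma>) (map (t \<circ> fst) v)"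
      unfolding act_def by (simp add: fold_map comp_def)
    then show "\<exists>u. set u \<subseteq> t ` S \<and> length u = length w \<and> \<rho> (word_prod G w) = fold (\<lambda>\<sigma>. \<sigma>) u"
      using v \<rho>[OF v(2)] unfolding repr_def
      by (intro exI[of _ "map (t \<circ> fst) v"]) auto
  next
    fix a assume "a \<in> S"
    then have "repr [(a, True)] a" using S by (auto simp: repr_def letter_def)
    from \<rho>[OF this] show "\<rho> a = t a" by (simp add: act_def)
  next
    fix x y assume "x \<in> carrier G" "y \<in> carrier G"
    then obtain v w where vw: "repr v x" "repr w y" using ex by blast
    then have "repr (v @ w) (x \<otimes> y)"
      using lett[of v] lett[of w] unfolding repr_def by (auto simp: word_prod_append simp del: set_map)
    from \<rho>[OF this] show "\<rho> (x \<otimes> y) = \<rho> y \<circ> \<rho> x"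
      using \<rho>[OF vw(1)] \<rho>[OF vw(2)] by (simp add: act_def)
  next
    have "repr [] \<one>" by (simp add: repr_def)
    from \<rho>[OF this] show "\<rho> \<one> = id" by (simp add: act_def id_def)
  qed
qed

text \<open>Two infinite sets of naturals are in bijection; glue a bijection to its inverse.\<close>

lemma swap_involution_exists:
  fixes W :: "nat set"
  assumes "infinite W" "infinite (- W)"
  obtains s where "s \<circ> s = id" "bij_betw s W (- W)"
proof -
  obtain h where h: "bij_betw h W (- W)"
  proof -
    have "bij_betw (from_nat_into (- W) \<circ> to_nat_on W) W (- W)"
      using assms by (intro bij_betw_trans[of _ _ UNIV] to_nat_on_infinite bij_betw_from_nat_into) auto
    then show ?thesis using that by blast
  qed
  define s where "s x = (if x \<in> W then h x else inv_into W h x)" for x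
  have "s (s x) = x" for x
    using bij_betw_inv_into_left[OF h, of x] bij_betw_inv_into_right[OF h, of x]
      bij_betw_apply[OF h, of x] bij_betw_apply[OF bij_betw_inv_into[OF h], of x]
    unfolding s_def by auto
  then have "s \<circ> s = id" by auto
  moreover have "bij_betw s W (- W)"
    using h by (rule bij_betw_cong[THEN iffD1, rotated]) (simp add: s_def)
  ultimately show ?thesis using that by blast
qed

section \<open>Transience\<close>

text \<open>The newest map is applied last, matching right multiplication by the newest increment in
  \<open>random_walk\<close> under a right action.\<close>

primrec perm_walk :: "(nat \<Rightarrow> 'w \<Rightarrow> 'x \<Rightarrow> 'x) \<Rightarrow> 'x \<Rightarrow> nat \<Rightarrow> 'w \<Rightarrow> 'x" where
  "perm_walk U x 0 \<omega> = x"
| "perm_walk U x (Suc n) \<omega> = U (Suc n) \<omega> (perm_walk U x n \<omega>)"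

text \<open>Exhibits the position as a function of the first \<open>n\<close> increments alone, the
  form from which independence of the next increment follows.\<close>

lemma perm_walk_restrict:
  "m \<le> n \<Longrightarrow> perm_walk (\<lambda>i f. f i) x m (\<lambda>i\<in>{1..n}. U i \<omega>) = perm_walk U x m \<omega>"
  by (induction m) auto

lemma measurable_perm_walk_PiM:
  fixes x :: "'x :: countable"
  shows "m \<le> n \<Longrightarrow> perm_walk (\<lambda>i f. f i) x m
    \<in> (PiM {1..n} (\<lambda>_. count_space UNIV)) \<rightarrow>\<^sub>M count_space UNIV"
proof (induction m)
  case (Suc m)
  \<comment> \<open>The increment is evaluated at a random point. Measurability is shown for each
    fixed \<open>y\<close>, and countability of the state space permits substituting the random
    position.\<close>
  have "(\<lambda>f. f (Suc m) y) \<in> (PiM {1..n} (\<lambda>_. count_space UNIV)) \<rightarrow>\<^sub>M count_space UNIV"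
    for y :: 'x
    by (rule measurable_compose[OF measurable_component_singleton[where i = "Suc m"]])
      (use Suc.prems in auto)
  from measurable_compose_countable[OF this Suc.IH] Suc.prems show ?case by simp
next
  case 0
  have "perm_walk (\<lambda>i f. f i) x 0 = (\<lambda>_. x)" by (rule ext) simp
  then show ?case by simp
qed

context prob_space
begin

text \<open>The occupation probabilities \<open>q n x\<close> obey the recursion of
  \<open>green_function_bound\<close>, so their partial sums are bounded and Borel-Cantelli applies
  to each of the countably many states.\<close>

lemma perm_walk_transient:
  fixes U :: "nat \<Rightarrow> 'a \<Rightarrow> 'x \<Rightarrow> 'x :: countable" and x0 :: 'x
  assumes ind: "indep_vars (\<lambda>_. count_space UNIV) U {1..}"
    and dist: "\<And>n. n \<ge> 1 \<Longrightarrow> distr M (count_space UNIV) (U n) = measure_pmf \<nu>"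
    and fin: "finite (set_pmf \<nu>)" and bij: "\<And>\<sigma>. \<sigma> \<in> set_pmf \<nu> \<Longrightarrow> bij \<sigma>"
    and c: "c > 0"
    and gap: "\<And>f. finite {x. f x \<noteq> 0} \<Longrightarrow>
      c * sqsum f \<le> (\<Sum>\<sigma>\<in>set_pmf \<nu>. pmf \<nu> \<sigma> * sqsum (\<lambda>x. f x - f (\<sigma> x)))"
  shows "AE \<omega> in M. \<forall>x. eventually (\<lambda>n. perm_walk U x0 n \<omega> \<noteq> x) sequentially"
proof -
  let ?V = "perm_walk U x0"
  have U [measurable]: "U n \<in> M \<rightarrow>\<^sub>M count_space UNIV" if "n \<ge> 1" for n
    using ind that unfolding indep_vars_def by auto
  \<comment> \<open>The library's \<open>indep_var\<close> wants both variables of one type; hence the constant functions.\<close>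
  have indVU: "indep_var (count_space UNIV) (\<lambda>\<omega> _. ?V n \<omega>) (count_space UNIV) (U (Suc n))" for n
  proof -
    have "(\<lambda>f _. perm_walk (\<lambda>i f. f i) x0 n f)
        \<in> (PiM {1..n} (\<lambda>_. count_space UNIV)) \<rightarrow>\<^sub>M (count_space UNIV :: ('x \<Rightarrow> 'x) measure)"
      by (rule measurable_compose[OF measurable_perm_walk_PiM]) simp_all
    moreover have "(\<lambda>f. f (Suc n))
        \<in> (PiM {Suc n} (\<lambda>_. count_space UNIV)) \<rightarrow>\<^sub>M (count_space UNIV :: ('x \<Rightarrow> 'x) measure)"
      by (rule measurable_component_singleton) simp
    ultimately have "indep_var (count_space UNIV)
        ((\<lambda>f _. perm_walk (\<lambda>i f. f i) x0 n f) \<circ> (\<lambda>\<omega>. \<lambda>i\<in>{1..n}. U i \<omega>))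
        (count_space UNIV) ((\<lambda>f. f (Suc n)) \<circ> (\<lambda>\<omega>. \<lambda>i\<in>{Suc n}. U i \<omega>))"
      by (intro indep_var_compose[OF indep_var_restrict[OF ind]]) auto
    then show ?thesis by (simp add: comp_def perm_walk_restrict del: One_nat_def)
  qed
  have V [measurable]: "?V n \<in> M \<rightarrow>\<^sub>M count_space UNIV" for n
    using measurable_compose[OF indep_var_rv1[OF indVU[of n]], of "\<lambda>f. f x0" "count_space UNIV"] by simp
  define q where "q n x = prob {\<omega> \<in> space M. ?V n \<omega> = x}" for n x
  have probU: "prob (U n -` {\<sigma>} \<inter> space M) = pmf \<nu> \<sigma>" if "n \<ge> 1" for n \<sigma>
    using measure_distr[OF U[OF that], of "{\<sigma>}"] dist[OF that] by (simp add: measure_pmf_single)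
  have AEU: "AE \<omega> in M. U n \<omega> \<in> set_pmf \<nu>" if "n \<ge> 1" for n
  proof -
    have "AE \<sigma> in distr M (count_space UNIV) (U n). \<sigma> \<in> set_pmf \<nu>"
      unfolding dist[OF that] by (simp add: AE_measure_pmf)
    then show ?thesis by (rule AE_distrD[OF U[OF that]])
  qed
  have qrec: "q (Suc n) x = (\<Sum>\<sigma>\<in>set_pmf \<nu>. pmf \<nu> \<sigma> * q n (inv_into UNIV \<sigma> x))" for n x
  proof -
    let ?E = "\<lambda>\<sigma>. {\<omega> \<in> space M. ?V n \<omega> = inv_into UNIV \<sigma> x \<and> U (Suc n) \<omega> = \<sigma>}"
    have E: "?E \<sigma> = (\<lambda>\<omega>. ((\<lambda>_ :: 'x. ?V n \<omega>), U (Suc n) \<omega>)) -` ({\<lambda>_. inv_into UNIV \<sigma> x} \<times> {\<sigma>}) \<inter> space M"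
      for \<sigma> by (auto simp: fun_eq_iff)
    have Em: "?E \<sigma> \<in> sets M" for \<sigma>
    proof -
      have "?E \<sigma> = (?V n -` {inv_into UNIV \<sigma> x} \<inter> space M) \<inter> (U (Suc n) -` {\<sigma>} \<inter> space M)" by auto
      then show ?thesis using measurable_sets[OF V[of n]] measurable_sets[OF U[of "Suc n"]] by auto
    qed
    \<comment> \<open>The event is split by the value of the last increment. Equality holds only
      almost surely, since the increment may leave the support of \<open>\<nu>\<close> on a null
      set.\<close>
    have "AE \<omega> in M. \<omega> \<in> {\<omega> \<in> space M. ?V (Suc n) \<omega> = x} \<longleftrightarrow> \<omega> \<in> (\<Union>\<sigma>\<in>set_pmf \<nu>. ?E \<sigma>)"
      using AEU[of "Suc n", simplified]
    proof eventually_elim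
      case (elim \<omega>)
      have "U (Suc n) \<omega> y = x \<longleftrightarrow> y = inv_into UNIV (U (Suc n) \<omega>) x" for y
        using bij[OF elim] by (metis bij_inv_eq_iff)
      with elim show ?case by auto
    qed
    then have "q (Suc n) x = prob (\<Union>\<sigma>\<in>set_pmf \<nu>. ?E \<sigma>)"
      unfolding q_def using Em fin by (intro finite_measure_eq_AE) (auto simp del: perm_walk.simps)
    also have "\<dots> = (\<Sum>\<sigma>\<in>set_pmf \<nu>. prob (?E \<sigma>))"
      using Em fin by (intro finite_measure_finite_Union) (auto simp: disjoint_family_on_def)
    also have "\<dots> = (\<Sum>\<sigma>\<in>set_pmf \<nu>. pmf \<nu> \<sigma> * q n (inv_into UNIV \<sigma> x))"
    proof (rule sum.cong[OF refl])
      fix \<sigma>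
      have "(\<lambda>\<omega> (_ :: 'x). ?V n \<omega>) -` {\<lambda>_. inv_into UNIV \<sigma> x} \<inter> space M
          = {\<omega> \<in> space M. ?V n \<omega> = inv_into UNIV \<sigma> x}" by (auto simp: fun_eq_iff)
      then show "prob (?E \<sigma>) = pmf \<nu> \<sigma> * q n (inv_into UNIV \<sigma> x)"
        using indep_varD[OF indVU, of "{\<lambda>_. inv_into UNIV \<sigma> x}" "{\<sigma>}" n] E[of \<sigma>]
        by (simp add: probU q_def)
    qed
    finally show ?thesis .
  qed
  have "summable (\<lambda>n. q n x)" for x
  proof (rule bounded_imp_summable)
    fix n
    have "(\<Sum>k<Suc n. q k x) \<le> 2 / c"
    proof (rule green_function_bound[where q = q and w = "pmf \<nu>", OF fin bij _ _ _ qrec c gap])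
      show "sum (pmf \<nu>) (set_pmf \<nu>) = 1" by (rule sum_pmf_eq_1[OF fin]) simp
      show "q 0 x = (if x = x0 then 1 else 0)" for x
        by (simp add: q_def prob_space)
    qed (simp_all add: q_def)
    then show "(\<Sum>k\<le>n. q k x) \<le> 2 / c" by (simp add: lessThan_Suc_atMost)
  qed (simp add: q_def)
  then have "AE \<omega> in M. eventually (\<lambda>n. \<omega> \<in> space M - {\<omega> \<in> space M. ?V n \<omega> = x}) sequentially" for x
    unfolding q_def by (intro borel_cantelli_AE1) (auto simp: emeasure_eq_measure)
  then have "AE \<omega> in M. \<forall>x. eventually (\<lambda>n. \<omega> \<in> space M - {\<omega> \<in> space M. ?V n \<omega> = x}) sequentially"
    unfolding AE_all_countable by blast
  then show ?thesis by (auto elim!: eventually_mono)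
qed

end

section \<open>The random walk on the free group\<close>

theorem theorem8:
  fixes G :: "('a, 'b) monoid_scheme" and S :: "'a set" and r :: nat
    and \<mu> :: "'a pmf" and M :: "'w measure" and Y :: "nat \<Rightarrow> 'w \<Rightarrow> 'a"
  defines "B \<equiv> punctured_ball G (symm_gens G S) r"
  defines "X \<equiv> cayley_graph G B"
  assumes "free_group_on G S" and "countable S" and "infinite S"
    and "set_pmf \<mu> \<subseteq> B"
    and "generate G (set_pmf \<mu>) = carrier G"
    and "prob_space M"
    and "prob_space.indep_vars M (\<lambda>_. count_space UNIV) Y {1..}"
    and "\<And>n. n \<ge> 1 \<Longrightarrow> distr M (count_space UNIV) (Y n) = measure_pmf \<mu>"
  shows "AE \<omega> in M. \<exists>\<xi> \<in> proper_metric_ends X.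
           limitin (proper_metric_end_topology X) (\<lambda>n. Inl (random_walk G Y n \<omega>)) (Inr \<xi>) sequentially"
proof -
  let ?A = "symm_gens G S"
  note free = \<open>free_group_on G S\<close>
  interpret group G using free by (simp add: free_group_on_def)
  have S: "S \<subseteq> carrier G" and genS: "generate G S = carrier G"
    using free by (simp_all add: free_group_on_def)
  interpret symm_generated G ?A
  proof
    show "?A \<subseteq> carrier G" using S by (auto simp: symm_gens_def)
    show "m_inv G ` ?A \<subseteq> ?A" using S by (auto simp: symm_gens_def subset_iff)
    show "\<exists>w. set w \<subseteq> ?A \<and> word_prod G w = x" if "x \<in> carrier G" for x
      using generate_words[OF S, of x] that genS by blast
  qed
  interpret prob_space M by fact
  have \<mu>_carrier: "set_pmf \<mu> \<subseteq> carrier G"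
    using \<open>set_pmf \<mu> \<subseteq> B\<close> by (auto simp: B_def punctured_ball_def)

  define W where "W i = {n :: nat. n mod 3 = i}" for i
  have "\<exists>s. s \<circ> s = id \<and> bij_betw s (W i) (- W i)" if "i < 3" for i
  proof -
    have inf: "infinite (W j)" if "j < 3" for j
    proof -
      have "range (\<lambda>k. 3 * k + j) \<subseteq> W j" using that by (auto simp: W_def)
      moreover have "infinite (range (\<lambda>k. 3 * k + j))"
        by (intro range_inj_infinite) (auto simp: inj_def)
      ultimately show ?thesis using finite_subset by blast
    qed
    \<comment> \<open>Another residue class inside the complement of \<open>W i\<close> shows that
      this complement is infinite.\<close>
    have "W (if i = 0 then 1 else 0) \<subseteq> - W i" by (auto simp: W_def)
    moreover have "infinite (W (if i = 0 then 1 else 0))" by (intro inf) simp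
    ultimately have "infinite (- W i)" using finite_subset by blast
    with inf[OF that] show ?thesis using swap_involution_exists by metis
  qed
  then obtain s where s: "\<And>i. i < 3 \<Longrightarrow> s i \<circ> s i = id"
    and sW: "\<And>i. i < 3 \<Longrightarrow> bij_betw (s i) (W i) (- W i)" by metis
  obtain a :: "nat \<Rightarrow> 'a" where a: "inj a" "range a \<subseteq> S"
    using infinite_countable_subset[OF \<open>infinite S\<close>] by blast
  \<comment> \<open>Only the generators \<open>a 0\<close>, \<open>a 1\<close>, \<open>a 2\<close>
    move points. Thus \<open>t\<close> takes at most four values, although \<open>S\<close> is
    infinite.\<close>
  define t where "t x = (if x \<in> a ` {..<3} then s (inv_into UNIV a x) else id)" for x
  have ta: "t (a i) = s i" if "i < 3" for i
    using that a(1) by (auto simp: t_def)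
  have tt: "t x \<circ> t x = id" for x
  proof (cases "x \<in> a ` {..<3}")
    case True
    then obtain i where "x = a i" "i < 3" by auto
    then show ?thesis using ta s by simp
  qed (simp add: t_def)
  have "t x \<in> insert id (s ` {..<3})" for x
  proof (cases "x \<in> a ` {..<3}")
    case True
    then show ?thesis using ta by auto
  qed (simp add: t_def)
  then have tfin: "finite (t ` S)"
    by (intro finite_subset[of "t ` S" "insert id (s ` {..<3})"] image_subsetI) simp_all
  obtain \<rho> where \<rho>_word: "\<And>w. set w \<subseteq> ?A \<Longrightarrow>
        \<exists>u. set u \<subseteq> t ` S \<and> length u = length w \<and> \<rho> (word_prod G w) = fold (\<lambda>\<sigma>. \<sigma>) u"
    and \<rho>_gen: "\<And>b. b \<in> S \<Longrightarrow> \<rho> b = t b"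
    and \<rho>_mult: "\<And>x y. x \<in> carrier G \<Longrightarrow> y \<in> carrier G \<Longrightarrow> \<rho> (x \<otimes>\<^bsub>G\<^esub> y) = \<rho> y \<circ> \<rho> x"
    and \<rho>_one: "\<rho> \<one>\<^bsub>G\<^esub> = id"
  proof (rule free_group_involution_action[where t = t, OF free tt], goal_cases)
    case (1 \<rho>)
    show ?case by (rule 1(1)[OF 1(2-5)])
  qed
  have \<rho>_finite: "finite (\<rho> ` {x \<in> carrier G. word_length G ?A x \<le> K})" for K
  proof (rule finite_subset)
    show "finite (fold (\<lambda>\<sigma>. \<sigma>) ` {u. set u \<subseteq> t ` S \<and> length u \<le> K})"
      by (intro finite_imageI finite_lists_length_le tfin)
    show "\<rho> ` {x \<in> carrier G. word_length G ?A x \<le> K}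
        \<subseteq> fold (\<lambda>\<sigma>. \<sigma>) ` {u. set u \<subseteq> t ` S \<and> length u \<le> K}"
    proof clarify
      fix x assume x: "x \<in> carrier G" "word_length G ?A x \<le> K"
      obtain w where w: "length w = word_length G ?A x" "set w \<subseteq> ?A" "word_prod G w = x"
        using word_length_word[OF x(1)] .
      from \<rho>_word[OF w(2)] w x(2) show "\<rho> x \<in> fold (\<lambda>\<sigma>. \<sigma>) ` {u. set u \<subseteq> t ` S \<and> length u \<le> K}"
        by force
    qed
  qed
  have \<rho>_inv: "\<rho> (inv\<^bsub>G\<^esub> x) \<circ> \<rho> x = id" "\<rho> x \<circ> \<rho> (inv\<^bsub>G\<^esub> x) = id" if "x \<in> carrier G" for x
    using \<rho>_mult[of x "inv\<^bsub>G\<^esub> x"] \<rho>_mult[of "inv\<^bsub>G\<^esub> x" x] that \<rho>_one by simp_all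
  have \<rho>_bij: "bij (\<rho> x)" if "x \<in> carrier G" for x
    using \<rho>_inv[OF that] by (rule o_bij)
  have \<rho>_inv_eq: "\<rho> (inv\<^bsub>G\<^esub> x) = inv_into UNIV (\<rho> x)" if "x \<in> carrier G" for x
    using inv_unique_comp[OF \<rho>_inv(2,1)[OF that]] by simp

  \<comment> \<open>The law of the acting permutation. Its support is finite even if that of
    \<open>\<mu>\<close> is not, so the Dirichlet form \<open>E\<close> is a finite sum.\<close>
  define \<nu> where "\<nu> = map_pmf \<rho> \<mu>"
  have set_\<nu>: "set_pmf \<nu> = \<rho> ` set_pmf \<mu>" by (simp add: \<nu>_def)
  have fin_\<nu>: "finite (set_pmf \<nu>)"
    using \<open>set_pmf \<mu> \<subseteq> B\<close> unfolding set_\<nu>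
    by (intro finite_subset[OF image_mono \<rho>_finite[of r]]) (auto simp: B_def punctured_ball_def)
  define E where "E f = (\<Sum>\<sigma>\<in>set_pmf \<nu>. pmf \<nu> \<sigma> * sqsum (\<lambda>x. f x - f (\<sigma> x)))" for f :: "nat \<Rightarrow> real"
  have sqsum_nonneg: "0 \<le> sqsum f" for f :: "nat \<Rightarrow> real"
    unfolding sqsum_def by (intro infsum_nonneg) simp
  have E_nonneg: "0 \<le> E f" for f
    unfolding E_def by (intro sum_nonneg mult_nonneg_nonneg sqsum_nonneg) simp
  have support_control: "sqsum (\<lambda>n. f n - f (\<rho> x n)) \<le> (1 / pmf \<nu> (\<rho> x)) * E f"
    if x: "x \<in> set_pmf \<mu>" for x f
  proof -
    have in_\<nu>: "\<rho> x \<in> set_pmf \<nu>" using x by (simp add: set_\<nu>)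
    have "pmf \<nu> (\<rho> x) * sqsum (\<lambda>n. f n - f (\<rho> x n)) \<le> E f"
      unfolding E_def by (rule member_le_sum[OF in_\<nu> _ fin_\<nu>]) (simp add: sqsum_nonneg)
    then show ?thesis using pmf_positive[OF in_\<nu>] by (simp add: field_simps)
  qed
  \<comment> \<open>Here the generation hypothesis enters: \<open>E\<close> controls displacement by
    elements of the support, and the bound passes to inverses and products. The constant depends on
    \<open>x\<close> but not on \<open>f\<close>.\<close>
  have control: "\<exists>C. \<forall>f. finite {n. f n \<noteq> 0} \<longrightarrow> sqsum (\<lambda>n. f n - f (\<rho> x n)) \<le> C * E f"
    if "x \<in> generate G (set_pmf \<mu>)" for x
    using that
  proof induction
    case one
    show ?case by (intro exI[of _ 0]) (simp add: \<rho>_one sqsum_def)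
  next
    case (incl x)
    from support_control[OF incl] show ?case by blast
  next
    case (inv x)
    have x: "x \<in> carrier G" using inv \<mu>_carrier by blast
    have "sqsum (\<lambda>n. f n - f (\<rho> (inv\<^bsub>G\<^esub> x) n)) \<le> (1 / pmf \<nu> (\<rho> x)) * E f" for f
      using support_control[OF inv, of f] sqsum_diff_inv[OF \<rho>_bij[OF x], of f]
      by (simp add: \<rho>_inv_eq[OF x])
    then show ?case by blast
  next
    case (eng x y)
    then obtain C D where
      C: "\<And>f. finite {n. f n \<noteq> 0} \<Longrightarrow> sqsum (\<lambda>n. f n - f (\<rho> x n)) \<le> C * E f" and
      D: "\<And>f. finite {n. f n \<noteq> 0} \<Longrightarrow> sqsum (\<lambda>n. f n - f (\<rho> y n)) \<le> D * E f" by blast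
    have xy: "x \<in> carrier G" "y \<in> carrier G"
      using eng.hyps \<open>generate G (set_pmf \<mu>) = carrier G\<close> by auto
    have "sqsum (\<lambda>n. f n - f (\<rho> (x \<otimes>\<^bsub>G\<^esub> y) n)) \<le> (2 * C + 2 * D) * E f"
      if "finite {n. f n \<noteq> 0}" for f
      using sqsum_diff_comp[OF that \<rho>_bij[OF xy(1)] \<rho>_bij[OF xy(2)]] C[OF that] D[OF that]
      by (simp add: \<rho>_mult[OF xy] algebra_simps)
    then show ?case by blast
  qed
  have "\<exists>C. \<forall>f. finite {n. f n \<noteq> 0} \<longrightarrow> sqsum (\<lambda>n. f n - f (s i n)) \<le> C * E f" if "i < 3" for i
  proof -
    have "a i \<in> S" using a(2) by auto
    then have "a i \<in> generate G (set_pmf \<mu>)" "\<rho> (a i) = s i"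
      using S \<open>generate G (set_pmf \<mu>) = carrier G\<close> ta[OF that] \<rho>_gen by auto
    from control[OF this(1)] this(2) show ?thesis by simp
  qed
  then obtain C where C: "\<And>i f. i < 3 \<Longrightarrow> finite {n. f n \<noteq> 0} \<Longrightarrow>
      sqsum (\<lambda>n. f n - f (s i n)) \<le> C i * E f" by metis
  \<comment> \<open>The signs of the \<open>C i\<close> are unknown; the absolute value and the
    added 1 keep the denominator positive.\<close>
  define c where "c = 1 / (6 * \<bar>\<Sum>i<3. C i\<bar> + 1)"
  have gap: "c * sqsum f \<le> E f" if f: "finite {n. f n \<noteq> 0}" for f
  proof -
    have "sqsum f \<le> 6 * (\<Sum>i<3. sqsum (\<lambda>n. f n - f (s i n)))"
      by (rule paradoxical_spectral_gap[OF f _ sW])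
        (auto simp: disjoint_family_on_def W_def intro: o_bij[OF s s])
    also have "\<dots> \<le> 6 * (\<Sum>i<3. C i * E f)" by (intro mult_left_mono sum_mono C f) auto
    also have "\<dots> = 6 * (\<Sum>i<3. C i) * E f" by (simp add: sum_distrib_right)
    also have "\<dots> \<le> (6 * \<bar>\<Sum>i<3. C i\<bar> + 1) * E f"
      by (intro mult_right_mono E_nonneg) simp
    finally show ?thesis unfolding c_def by (simp add: field_simps)
  qed

  have Y: "Y n \<in> M \<rightarrow>\<^sub>M count_space UNIV" if "n \<ge> 1" for n
    using \<open>indep_vars (\<lambda>_. count_space UNIV) Y {1..}\<close> that unfolding indep_vars_def by auto
  define U where "U n \<omega> = \<rho> (Y n \<omega>)" for n \<omega>
  have "AE \<omega> in M. \<forall>x. eventually (\<lambda>n. perm_walk U 0 n \<omega> \<noteq> x) sequentially"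
  proof (rule perm_walk_transient)
    show "indep_vars (\<lambda>_. count_space UNIV) U {1..}"
      unfolding U_def by (rule indep_vars_compose2[OF \<open>indep_vars (\<lambda>_. count_space UNIV) Y {1..}\<close>]) simp
    show "distr M (count_space UNIV) (U n) = measure_pmf \<nu>" if "n \<ge> 1" for n
    proof -
      have "distr M (count_space UNIV) (U n)
          = distr (distr M (count_space UNIV) (Y n)) (count_space UNIV) \<rho>"
        unfolding U_def by (subst distr_distr) (simp_all add: Y[OF that] comp_def)
      also have "\<dots> = distr (measure_pmf \<mu>) (count_space UNIV) \<rho>"
        using assms(10)[OF that] by simp
      also have "\<dots> = measure_pmf \<nu>" by (simp add: \<nu>_def map_pmf_rep_eq)
      finally show ?thesis .
    qed
    show "bij \<sigma>" if "\<sigma> \<in> set_pmf \<nu>" for \<sigma>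
      using that \<rho>_bij \<mu>_carrier unfolding set_\<nu> by auto
    show "c > 0" unfolding c_def by (simp add: add_nonneg_pos)
    show "c * sqsum f \<le> (\<Sum>\<sigma>\<in>set_pmf \<nu>. pmf \<nu> \<sigma> * sqsum (\<lambda>x. f x - f (\<sigma> x)))"
      if "finite {x. f x \<noteq> 0}" for f
      using gap[OF that] by (simp add: E_def)
  qed (rule fin_\<nu>)
  \<comment> \<open>Almost surely all increments lie in the support, so consecutive positions are
    adjacent in \<open>X\<close>.\<close>
  moreover have "AE \<omega> in M. \<forall>n\<in>{1..}. Y n \<omega> \<in> set_pmf \<mu>"
  proof (subst AE_ball_countable)
    show "\<forall>n\<in>{1..}. AE \<omega> in M. Y n \<omega> \<in> set_pmf \<mu>"
    proof
      fix n :: nat assume "n \<in> {1..}"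
      then have n: "n \<ge> 1" by simp
      have "AE y in distr M (count_space UNIV) (Y n). y \<in> set_pmf \<mu>"
        unfolding assms(10)[OF n] by (simp add: AE_measure_pmf)
      then show "AE \<omega> in M. Y n \<omega> \<in> set_pmf \<mu>" by (rule AE_distrD[OF Y[OF n]])
    qed
  qed simp
  ultimately show ?thesis
  proof eventually_elim
    case (elim \<omega>)
    let ?Z = "\<lambda>n. random_walk G Y n \<omega>"
    have Yin: "Y (Suc n) \<omega> \<in> B" "Y (Suc n) \<omega> \<in> carrier G" for n
      using elim(2) \<open>set_pmf \<mu> \<subseteq> B\<close> \<mu>_carrier by auto
    have Z: "?Z n \<in> carrier G" for n by (induction n) (simp_all add: Yin)
    have V: "perm_walk U 0 n \<omega> = \<rho> (?Z n) 0" for n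
      by (induction n) (simp_all add: \<rho>_one \<rho>_mult Z Yin U_def)
    have lim: "eventually (\<lambda>n. K < word_length G ?A (?Z n)) sequentially" for K
    proof -
      \<comment> \<open>\<open>?P\<close> is the finite set of points to which the ball of radius
        \<open>K\<close> moves 0. Once the projected walk has left \<open>?P\<close> for good, the
        walk has left the ball.\<close>
      let ?P = "(\<lambda>\<sigma>. \<sigma> 0) ` \<rho> ` {x \<in> carrier G. word_length G ?A x \<le> K}"
      have "eventually (\<lambda>n. \<forall>x\<in>?P. perm_walk U 0 n \<omega> \<noteq> x) sequentially"
        using elim(1) \<rho>_finite by (intro eventually_ball_finite) auto
      then show ?thesis
      proof eventually_elim
        case (elim n)
        show ?case
        proof (rule ccontr)
          assume "\<not> K < word_length G ?A (?Z n)"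
          then have "?Z n \<in> {x \<in> carrier G. word_length G ?A x \<le> K}" using Z[of n] by simp
          then have "\<rho> (?Z n) 0 \<in> ?P" by (intro imageI)
          with elim V show False by metis
        qed
      qed
    qed
    show ?case
    proof (rule escaping_walk_converges)
      show "adj X x y \<Longrightarrow> adj X y x" for x y
        unfolding X_def B_def by (rule cayley_graph_adj_sym)
      show "?Z n \<in> verts X" for n using Z by (simp add: X_def cayley_graph_def)
      have "inv\<^bsub>G\<^esub> (?Z n) \<otimes>\<^bsub>G\<^esub> (?Z n \<otimes>\<^bsub>G\<^esub> Y (Suc n) \<omega>) = Y (Suc n) \<omega>" for n
        using Z Yin by (simp flip: m_assoc)
      then show "adj X (?Z n) (?Z (Suc n))" for n
        using Z[of n] Z[of "Suc n"] Yin by (simp add: X_def cayley_graph_def)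
      show "eventually (\<lambda>n. enat N < gdist X x (?Z n)) sequentially" if "x \<in> verts X" for x N
        unfolding X_def B_def using that
        by (intro gdist_escape Z lim) (simp add: X_def cayley_graph_def)
    qed
  qed
qed

end
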